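(* Let $\mathbb{F}_q$ be a finite field with $q$ elements, let $P(X,Z)\in\mathbb{F}_q[X,Z]$ be monic in $Z$ with $\deg_Z P\ge 2$, and let $Q(X,Y,Z)\in\mathbb{F}_q[X,Y,Z]$ be monic in $Y$ with $\deg_Y Q\ge 2$. Let $$N_0'=\#\{(\beta,\gamma)\in\mathbb{F}_q^2\mid P(0,\gamma)=0,\ Q(0,\beta,\gamma)=0\}.$$ Let $\gamma_1,\dots,\gamma_r$ be the distinct roots of $P(0,Z)$ in $\mathbb{F}_q$. Let $R(Y,Z)\in\mathbb{F}_q[Y,Z]$ be the unique polynomial satisfying $R(Y,Z)\equiv Q(0,Y,Z)\pmod{Y^q-Y}$ and $\deg_Y R\le q-1$. Write $$R(Y,Z)=\sum_{i=0}^{q-1}a_i(Z)Y^i,\qquad R_{\gamma_j}(Y):=R(Y,\gamma_j)=\sum_{i=0}^{q-1}a_i(\gamma_j)Y^i.$$ After reindexing if necessary, assume that $a_0(\gamma_j)=0$ for $1\le j\le t$ and $a_0(\gamma_j)\ne 0$ for $t+1\le j\le r$. For each $j=1,\dots,r$ define $$S_{\gamma_j}(Y)=\begin{cases}\dfrac{R_{\gamma_j}(Y)}{Y}, & \text{if } a_0(\gamma_j)=0,\\[1ex] \bigl(a_0(\gamma_j)+a_{q-1}(\gamma_j)\bigr)+a_1(\gamma_j)Y+\cdots+a_{q-2}(\gamma_j)Y^{q-2}, & \text{if } a_0(\gamma_j)\neq 0,\end{cases}$$ and let $\rho_{\gamma_j}$ denote the rank of the left circulant matrix associated with $S_{\gamma_j}(Y)$.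 Then $$N_0'=r(q-1)-\sum_{j=1}^r\rho_{\gamma_j}+t.$$
   Context: For a polynomial $f(Y)=c_0+c_1Y+\cdots+c_{q-2}Y^{q-2}\in\mathbb{F}_q[Y]$ (degree at most $q-2$), the left circulant matrix associated with $f$ is the $(q-1)\times(q-1)$ matrix $(c_{i+j})_{0\le i,j\le q-2}$ over $\mathbb{F}_q$, with indices taken modulo $q-1$. "Monic in $Z$" means leading coefficient $1$ as a polynomial in $Z$ over the polynomial ring in the other variables; similarly for $Y$. *)

theory Defs
  imports
    "HOL-Library.Cardinality"
    "Jordan_Normal_Form.DL_Rank"
begin

text \<open>Multivariate polynomials are iterated univariate ones, the variable of leading-coefficient
  statements being outermost: \<open>P \<in> \<bbbF>\<^sub>q[X][Z]\<close> has type \<open>'a poly poly\<close>,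
  \<open>Q \<in> \<bbbF>\<^sub>q[X][Z][Y]\<close> has type \<open>'a poly poly poly\<close> and
  \<open>Q(0,Y,Z), R(Y,Z) \<in> \<bbbF>\<^sub>q[Z][Y]\<close> have type \<open>'a poly poly\<close>.
  The field is the type \<open>'a\<close>, and \<open>q = CARD('a)\<close>.\<close>

definition P_at_X0 :: "'a::field poly poly \<Rightarrow> 'a poly" where
  "P_at_X0 P = map_poly (\<lambda>p. poly p 0) P"

definition Q_at_X0 :: "'a::field poly poly poly \<Rightarrow> 'a poly poly" where
  "Q_at_X0 Q = map_poly (map_poly (\<lambda>p. poly p 0)) Q"

definition spec_Z :: "'a::field poly poly \<Rightarrow> 'a \<Rightarrow> 'a poly" where
  "spec_Z R c = map_poly (\<lambda>a. poly a c) R"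

definition N0' :: "'a::{field,finite} poly poly \<Rightarrow> 'a poly poly poly \<Rightarrow> nat" where
  "N0' P Q = card {(b, c). poly (P_at_X0 P) c = 0 \<and> poly (spec_Z (Q_at_X0 Q) c) b = 0}"

definition is_Y_reduction :: "'a::{field,finite} poly poly \<Rightarrow> 'a poly poly \<Rightarrow> bool" where
  "is_Y_reduction F R \<longleftrightarrow>
     (monom 1 CARD('a) - monom 1 1) dvd (R - F) \<and> degree R \<le> CARD('a) - 1"

definition left_circulant :: "'a::{field,finite} poly \<Rightarrow> 'a mat" where
  "left_circulant f =
     mat (CARD('a) - 1) (CARD('a) - 1) (\<lambda>(i, j). coeff f ((i + j) mod (CARD('a) - 1)))"

definition left_circulant_rank :: "'a::{field,finite} poly \<Rightarrow> nat" where
  "left_circulant_rank f = vec_space.rank (CARD('a) - 1) (left_circulant f)"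

text \<open>In the first case the division by \<open>Y\<close> is exact, since the constant coefficient of
  \<open>R(Y,c)\<close> is \<open>a\<^sub>0(c) = 0\<close>.\<close>

definition S_poly :: "'a::{field,finite} poly poly \<Rightarrow> 'a \<Rightarrow> 'a poly" where
  "S_poly R c =
     (if poly (coeff R 0) c = 0 then spec_Z R c div [:0, 1:]
      else [:poly (coeff R 0) c + poly (coeff R (CARD('a) - 1)) c:]
           + (\<Sum>i = 1..CARD('a) - 2. monom (poly (coeff R i) c) i))"

lemma ex1_Y_reduction:
  fixes F :: "'a::{field,finite} poly poly"
  shows "\<exists>!R. is_Y_reduction F R"
proof -
  let ?q = "CARD('a)"
  define g :: "'a poly poly" where "g = monom 1 ?q - monom 1 1"
  have "card {0, 1 :: 'a} \<le> ?q" by (intro card_mono) auto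
  then have q: "?q \<ge> 2" by simp
  have cg: "coeff g ?q = 1" using q by (simp add: g_def)
  have dg: "degree g = ?q"
  proof (rule antisym)
    show "degree g \<le> ?q"
      unfolding g_def by (rule degree_diff_le) (use q in \<open>auto simp: degree_monom_eq\<close>)
    show "?q \<le> degree g" by (rule le_degree) (simp add: cg)
  qed
  have g0: "g \<noteq> 0" using cg by auto
  show ?thesis
  proof (rule ex_ex1I)
    obtain d r where dr: "pseudo_divmod F g = (d, r)" by fastforce
    from pseudo_divmod[OF g0 dr] have eq: "F = g * d + r" and r: "r = 0 \<or> degree r < degree g"
      by (simp_all add: dg cg)
    have "r - F = g * (- d)" using eq by simp
    then have "g dvd r - F" by (rule dvdI)
    moreover have "degree r \<le> ?q - 1" using r dg q by auto
    ultimately show "\<exists>R. is_Y_reduction F R" by (auto simp: is_Y_reduction_def g_def)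
  next
    fix R R' assume "is_Y_reduction F R" "is_Y_reduction F R'"
    then have d: "g dvd R - F" "g dvd R' - F" and b: "degree R \<le> ?q - 1" "degree R' \<le> ?q - 1"
      by (auto simp: is_Y_reduction_def g_def)
    have "g dvd R - R'" using dvd_diff[OF d] by simp
    moreover have "degree (R - R') < degree g"
      using degree_diff_le[OF b] q unfolding dg by linarith
    ultimately have "R - R' = 0" by (meson dvd_imp_degree_le linorder_not_le)
    then show "R = R'" by simp
  qed
qed

end

theory Submission
  imports Defs
begin

text \<open>For each root \<open>c\<close> of \<open>P(0,Z)\<close>, the polynomial \<open>S\<^sub>c\<close> has degree at most \<open>q - 2\<close> and the same nonzero
  roots as \<open>Q(0,Y,c)\<close>, because \<open>y\<^sup>q = y\<close> and, for \<open>y \<noteq> 0\<close>, \<open>y\<close> to the power \<open>q - 1\<close> is \<open>1\<close>. By the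
  Koenig-Rados theorem there are \<open>q - 1 - \<rho>\<^sub>c\<close> of them, and \<open>0\<close> is a further root of \<open>Q(0,Y,c)\<close> exactly
  for the \<open>t\<close> roots \<open>c\<close> with \<open>a\<^sub>0(c) = 0\<close>.\<close>

section \<open>Power sums over a finite field and its units\<close>

lemma card_field_ge2: "CARD('a::{field,finite}) \<ge> 2"
proof -
  have "card {0, 1 :: 'a} \<le> CARD('a)" by (intro card_mono) auto
  then show ?thesis by simp
qed

lemma card_units: "card (- {0 :: 'a::{field,finite}}) = CARD('a) - 1"
  by (simp add: Compl_eq_Diff_UNIV card_Diff_singleton)

text \<open>Translation by 1 permutes the field, so the sum of all elements does not change when q
  copies of 1 are added to it; hence q vanishes in the field.\<close>

lemma of_nat_card_field_minus_1: "of_nat (CARD('a::{field,finite}) - 1) = (-1 :: 'a)"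
proof -
  have "(\<Sum>x\<in>UNIV. 1 + x) = \<Sum>(UNIV :: 'a set)"
    by (rule sum.reindex_bij_betw) (rule bij_betwI[where g = "\<lambda>x. x - 1"], auto)
  then have "of_nat CARD('a) = (0 :: 'a)"
    by (simp add: sum.distrib)
  then show ?thesis
    using card_field_ge2[where 'a = 'a] by (simp)
qed

lemma bij_betw_mult_nonzero:
  fixes y :: "'a::field"
  assumes "y \<noteq> 0"
  shows "bij_betw ((*) y) (- {0}) (- {0})"
  by (rule bij_betwI[where g = "(*) (inverse y)"]) (use assms in \<open>auto simp flip: mult.assoc\<close>)

text \<open>Multiplication by \<open>y\<close> permutes the units, so their nonzero product absorbs
  the factor \<open>y ^ (q - 1)\<close>.\<close>

lemma power_card_field_minus_1:
  fixes y :: "'a::{field,finite}"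
  assumes "y \<noteq> 0"
  shows "y ^ (CARD('a) - 1) = 1"
proof -
  have "(\<Prod>x\<in>-{0::'a}. y * x) = \<Prod>(-{0})"
    using prod.reindex_bij_betw[OF bij_betw_mult_nonzero[OF assms], of "\<lambda>x. x"] by simp
  then have "y ^ card (-{0::'a}) * \<Prod>(-{0}) = \<Prod>(-{0})"
    by (simp add: prod.distrib)
  then show ?thesis by (simp add: card_units)
qed

lemma power_card_field:
  fixes y :: "'a::{field,finite}"
  shows "y ^ CARD('a) = y"
proof (cases "y = 0")
  case False
  have "y ^ CARD('a) = y ^ Suc (CARD('a) - 1)" by (simp del: power_Suc)
  then show ?thesis by (simp only: power_Suc power_card_field_minus_1[OF False] mult_1_right)
qed (simp add: zero_power)

text \<open>A geometric sum whose ratio \<open>z / y\<close> is a (q-1)-th root of unity: it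
  vanishes unless the ratio is 1, and then it counts q - 1 ones.\<close>

lemma sum_power_mult_inverse:
  fixes y z :: "'a::{field,finite}"
  assumes "y \<noteq> 0" "z \<noteq> 0"
  shows "(\<Sum>i<CARD('a) - 1. z ^ i * inverse y ^ i) = (if y = z then -1 else 0)"
proof (cases "y = z")
  case True
  then show ?thesis
    using assms of_nat_card_field_minus_1[where 'a = 'a]
    by (simp flip: power_mult_distrib)
next
  case False
  let ?u = "z * inverse y"
  have "?u \<noteq> 1" using False assms by (auto simp: field_simps)
  moreover have "(?u - 1) * (\<Sum>i<CARD('a) - 1. ?u ^ i) = 0"
    using power_diff_1_eq[of ?u "CARD('a) - 1"] power_card_field_minus_1[of ?u] assms by simp
  ultimately show ?thesis using False by (simp add: power_mult_distrib)
qed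

text \<open>The dual orthogonality relation. Substituting \<open>z * y\<close> for \<open>y\<close>
  multiplies the sum by \<open>z ^ m / z ^ k\<close>, so the sum is 0 as soon as some unit
  \<open>z\<close> separates the two powers.\<close>

lemma sum_units_power_mult_inverse:
  fixes m k :: nat
  assumes "m < CARD('a::{field,finite}) - 1" "k < CARD('a) - 1"
  shows "(\<Sum>y\<in>-{0::'a}. y ^ m * inverse y ^ k) = (if m = k then -1 else 0)"
proof (cases "m = k")
  case True
  have "(\<Sum>y\<in>-{0::'a}. y ^ k * inverse y ^ k) = (\<Sum>y\<in>-{0::'a}. 1)"
    by (intro sum.cong) (auto simp flip: power_mult_distrib)
  then show ?thesis
    using True of_nat_card_field_minus_1[where 'a = 'a] by (simp add: card_units)
next
  case False
  \<comment> \<open>A separating unit exists by counting roots, with no appeal to a generator of the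
    unit group: \<open>p\<close> has too small a degree to vanish at all q - 1 units.\<close>
  define p :: "'a poly" where "p = monom 1 m - monom 1 k"
  have "coeff p m = 1" using False by (simp add: p_def)
  then have "p \<noteq> 0" by auto
  have "degree p < CARD('a) - 1"
    unfolding p_def by (rule degree_diff_less) (use assms in \<open>auto simp: degree_monom_eq\<close>)
  have "\<not> (-{0}) \<subseteq> {y. poly p y = 0}"
  proof
    assume "(-{0}) \<subseteq> {y. poly p y = 0}"
    then have "card (-{0::'a}) \<le> card {y. poly p y = 0}" by (intro card_mono) auto
    also have "\<dots> \<le> degree p" using \<open>p \<noteq> 0\<close> by (rule card_poly_roots_bound)
    finally show False using \<open>degree p < _\<close> by (simp add: card_units)
  qed
  then obtain z where "z \<noteq> 0" "poly p z \<noteq> 0" by auto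
  then have z: "z \<noteq> 0" "z ^ m \<noteq> z ^ k" by (simp_all add: p_def poly_monom)
  let ?s = "\<Sum>y\<in>-{0::'a}. y ^ m * inverse y ^ k"
  have "?s = (\<Sum>y\<in>-{0::'a}. (z * y) ^ m * inverse (z * y) ^ k)"
    using sum.reindex_bij_betw[OF bij_betw_mult_nonzero[OF z(1)],
        of "\<lambda>y. y ^ m * inverse y ^ k"] by simp
  also have "\<dots> = z ^ m * inverse z ^ k * ?s"
    by (simp add: sum_distrib_left power_mult_distrib mult_ac)
  finally have "z ^ k * ?s = z ^ m * ?s"
    using z(1) by (simp add: field_simps)
  then show ?thesis using False z by simp
qed

section \<open>Left circulant matrices and their rank\<close>

lemma poly_eq_sum_coeff:
  fixes f :: "'a::comm_semiring_1 poly"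
  assumes "degree f < n"
  shows "poly f x = (\<Sum>i<n. coeff f i * x ^ i)"
  unfolding poly_altdef
  by (rule sum.mono_neutral_left) (use assms in \<open>auto simp: coeff_eq_0\<close>)

text \<open>Fourier inversion on the unit group; the usual normalisation 1/(q-1) is -1 here.\<close>

lemma coeff_eq_sum_units:
  fixes f :: "'a::{field,finite} poly"
  assumes "degree f < CARD('a) - 1" "k < CARD('a) - 1"
  shows "coeff f k = - (\<Sum>y\<in>-{0}. poly f y * inverse y ^ k)"
proof -
  have "(\<Sum>y\<in>-{0}. poly f y * inverse y ^ k)
      = (\<Sum>m<CARD('a) - 1. coeff f m * (\<Sum>y\<in>-{0}. y ^ m * inverse y ^ k))"
    unfolding poly_eq_sum_coeff[OF assms(1)] sum_distrib_left sum_distrib_right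
    by (subst sum.swap) (simp add: mult.assoc)
  also have "\<dots> = (\<Sum>m<CARD('a) - 1. if m = k then - coeff f m else 0)"
    by (intro sum.cong) (use assms in \<open>simp_all add: sum_units_power_mult_inverse\<close>)
  also have "\<dots> = - coeff f k"
    using assms(2) by simp
  finally show ?thesis by simp
qed

text \<open>The wrap-around of the index is invisible to powers of a unit, so Fourier inversion
  factors the matrix as \<open>V^T D V\<close> with \<open>V\<close> the Vandermonde matrix of the
  inverse units and \<open>D\<close> diagonal with entries \<open>- f(y)\<close>.\<close>

lemma left_circulant_index:
  fixes f :: "'a::{field,finite} poly"
  assumes "degree f < CARD('a) - 1" "i < CARD('a) - 1" "j < CARD('a) - 1"
  shows "left_circulant f $$ (i, j) = - (\<Sum>y\<in>-{0}. poly f y * inverse y ^ i * inverse y ^ j)"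
proof -
  let ?n = "CARD('a) - 1"
  have "inverse y ^ ((i + j) mod ?n) = inverse y ^ i * inverse y ^ j" if "y \<noteq> 0" for y :: 'a
  proof -
    have "inverse y ^ (?n * ((i + j) div ?n)) = 1"
      using power_card_field_minus_1[of "inverse y"] that unfolding power_mult by simp
    then have "inverse y ^ ((i + j) mod ?n)
        = inverse y ^ (?n * ((i + j) div ?n) + (i + j) mod ?n)"
      unfolding power_add by simp
    then show ?thesis unfolding mult_div_mod_eq power_add .
  qed
  moreover have "(i + j) mod ?n < ?n" using assms(2) by simp
  ultimately show ?thesis
    using assms by (simp add: left_circulant_def coeff_eq_sum_units mult.assoc)
qed

text \<open>If \<open>f(y) \<noteq> 0\<close>, then \<open>(y\<^sup>-\<^sup>i)\<^sub>i\<close> is up to the factor \<open>f(y)\<close> the image of \<open>(y\<^sup>j)\<^sub>j\<close> under the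
  circulant matrix, and these vectors form a basis of the column space.\<close>

theorem Koenig_Rados:
  fixes f :: "'a::{field,finite} poly"
  assumes deg: "degree f < CARD('a) - 1"
  shows "card {y. y \<noteq> 0 \<and> poly f y = 0} + left_circulant_rank f = CARD('a) - 1"
proof -
  define n where "n = CARD('a) - 1"
  let ?C = "left_circulant f"
  interpret vec_space "TYPE('a)" n .
  define w where "w = (\<lambda>y::'a. vec n (\<lambda>i. inverse y ^ i))"
  define Y where "Y = {y. y \<noteq> 0 \<and> poly f y \<noteq> 0}"
  have C: "?C \<in> carrier_mat n n" by (simp add: left_circulant_def n_def)
  have w: "w ` Y \<subseteq> carrier_vec n" by (auto simp: w_def)
  have Y0: "y \<noteq> 0" if "y \<in> Y" for y using that by (simp add: Y_def)
  \<comment> \<open>The functionals with coordinates \<open>z ^ i\<close> are, up to sign, dual to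
    the vectors \<open>w y\<close>; this yields both injectivity of \<open>w\<close> and linear
    independence.\<close>
  have pair_w: "(\<Sum>i<n. z ^ i * w y $ i) = (if y = z then -1 else 0)"
    if "y \<in> Y" "z \<in> Y" for y z
    using sum_power_mult_inverse[of y z, folded n_def] Y0 that by (simp add: w_def)
  have inj: "inj_on w Y"
  proof (rule inj_onI)
    fix y z assume yz: "y \<in> Y" "z \<in> Y" "w y = w z"
    then show "y = z" using pair_w[of y z] pair_w[of z z] by (auto split: if_splits)
  qed
  have lincomb_w: "lincomb a (w ` Y) $ i = (\<Sum>y\<in>Y. a (w y) * w y $ i)" if "i < n" for a i
    using lincomb_index[OF that w, of a] by (simp add: sum.reindex[OF inj])
  have indpt: "lin_indpt (w ` Y)"
  proof
    assume "lin_dep (w ` Y)"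
    then obtain a v where a: "lincomb a (w ` Y) = 0\<^sub>v n" "v \<in> w ` Y" "a v \<noteq> 0"
      using finite_lin_dep[of "w ` Y"] w by auto
    from a(2) obtain z where z: "z \<in> Y" "v = w z" by auto
    have "0 = (\<Sum>i<n. z ^ i * lincomb a (w ` Y) $ i)" by (simp add: a(1))
    also have "\<dots> = (\<Sum>y\<in>Y. a (w y) * (\<Sum>i<n. z ^ i * w y $ i))"
      unfolding sum_distrib_left
      by (subst sum.swap) (simp add: lincomb_w sum_distrib_left mult_ac)
    also have "\<dots> = (\<Sum>y\<in>Y. if y = z then - a (w y) else 0)"
      by (intro sum.cong) (auto simp: pair_w z)
    also have "\<dots> = - a v" using z by simp
    finally show False using a(3) by simp
  qed
  have "w y \<in> span (set (cols ?C))" if y: "y \<in> Y" for y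
  proof -
    \<comment> \<open>Orthogonality leaves only the summand \<open>z = y\<close>, where the sign of
      the matrix entry cancels the -1 of the power sum and the division removes
      \<open>poly f y\<close>.\<close>
    let ?x = "vec n (\<lambda>j. y ^ j / poly f y)"
    have "?C *\<^sub>v ?x = w y"
    proof (rule eq_vecI)
      fix i assume "i < dim_vec (w y)"
      then have i: "i < n" by (simp add: w_def)
      have "(?C *\<^sub>v ?x) $ i = (\<Sum>j<n. ?C $$ (i, j) * (y ^ j / poly f y))"
        using C i by (simp add: scalar_prod_def lessThan_atLeast0)
      also have "\<dots> = (\<Sum>j<n. \<Sum>z\<in>-{0}. - (poly f z * inverse z ^ i / poly f y) * (y ^ j * inverse z ^ j))"
        by (intro sum.cong refl)
          (simp add: left_circulant_index[OF deg, folded n_def] i sum_distrib_left sum_divide_distrib sum_negf mult_ac)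
      also have "\<dots> = (\<Sum>z\<in>-{0}. - (poly f z * inverse z ^ i / poly f y) * (\<Sum>j<n. y ^ j * inverse z ^ j))"
        unfolding sum_distrib_left by (rule sum.swap)
      also have "\<dots> = (\<Sum>z\<in>-{0}. if z = y then poly f z * inverse z ^ i / poly f y else 0)"
        by (intro sum.cong) (use Y0[OF y] in \<open>auto simp: sum_power_mult_inverse[where 'a = 'a, folded n_def]\<close>)
      also have "\<dots> = w y $ i"
        using y i by (simp add: w_def Y_def)
      finally show "(?C *\<^sub>v ?x) $ i = w y $ i" .
    qed (use C in \<open>simp add: w_def\<close>)
    moreover have "w y \<in> carrier_vec n" using w y by auto
    ultimately have "w y \<in> col_space ?C"
      using C by (auto simp: col_space_eq[OF C] intro!: bexI[of _ ?x])
    then show ?thesis by (simp add: col_space_def)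
  qed
  moreover have "v \<in> span (w ` Y)" if "v \<in> set (cols ?C)" for v
  proof -
    from that C obtain j where j: "j < n" "v = col ?C j"
      by (auto simp: cols_def)
    \<comment> \<open>Coefficients in \<open>lincomb\<close> are indexed by vectors, so
      \<open>y\<close> is recovered from \<open>w y\<close>. Units outside \<open>Y\<close> drop out
      of the entry formula because \<open>f\<close> vanishes there.\<close>
    define a where "a = (\<lambda>u. - (poly f (the_inv_into Y w u) * inverse (the_inv_into Y w u) ^ j))"
    have "v = lincomb a (w ` Y)"
    proof (rule eq_vecI)
      fix i assume "i < dim_vec (lincomb a (w ` Y))"
      then have i: "i < n" by (simp add: lincomb_dim w)
      have "v $ i = - (\<Sum>y\<in>-{0}. poly f y * inverse y ^ i * inverse y ^ j)"
        using C i j by (simp add: left_circulant_index[OF deg, folded n_def])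
      also have "(\<Sum>y\<in>-{0}. poly f y * inverse y ^ i * inverse y ^ j)
          = (\<Sum>y\<in>Y. poly f y * inverse y ^ i * inverse y ^ j)"
        by (rule sum.mono_neutral_right) (auto simp: Y_def)
      also have "- \<dots> = (\<Sum>y\<in>Y. a (w y) * w y $ i)"
        unfolding sum_negf[symmetric]
      proof (intro sum.cong refl)
        fix y assume "y \<in> Y"
        then have "a (w y) = - (poly f y * inverse y ^ j)"
          by (simp add: a_def the_inv_into_f_f[OF inj])
        moreover have "w y $ i = inverse y ^ i" using i by (simp add: w_def)
        ultimately show "- (poly f y * inverse y ^ i * inverse y ^ j) = a (w y) * w y $ i"
          by (simp add: mult_ac)
      qed
      also have "\<dots> = lincomb a (w ` Y) $ i" by (rule lincomb_w[OF i, symmetric])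
      finally show "v $ i = lincomb a (w ` Y) $ i" .
    qed (use C j w in \<open>simp add: lincomb_dim\<close>)
    then show ?thesis by auto
  qed
  ultimately have "span (set (cols ?C)) = span (w ` Y)"
    using w cols_dim[of ?C] C
    by (intro equalityI span_subsetI) auto
  then have "left_circulant_rank f = vectorspace.dim class_ring (span_vs (w ` Y))"
    unfolding left_circulant_rank_def n_def[symmetric] rank_def by simp
  also have "\<dots> = card (w ` Y)"
    by (rule dim_span) (use w indpt in \<open>auto simp: maximal_def\<close>)
  also have "\<dots> = card Y" by (rule card_image[OF inj])
  finally have "left_circulant_rank f = card Y" .
  moreover have "card {y. y \<noteq> 0 \<and> poly f y = 0} + card Y = card (- {0::'a})"
    by (subst card_Un_disjoint[symmetric]) (auto simp: Y_def intro!: arg_cong[where f = card])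
  ultimately show ?thesis by (simp add: card_units)
qed

section \<open>Specialisation at a root and the polynomials \<open>S_poly\<close>\<close>

lemma poly_spec_Z: "poly (spec_Z F c) b = poly (poly F [:b:]) c"
  unfolding spec_Z_def by (induction F) (simp_all add: map_poly_pCons)

text \<open>The multiple of \<open>Y^q - Y\<close> dies since \<open>b ^ q = b\<close>. Evaluating
  at the constant \<open>[:b:]\<close> first lets the ring rules for \<open>poly\<close> handle the
  product.\<close>

lemma poly_spec_Z_Y_reduction:
  fixes F R :: "'a::{field,finite} poly poly"
  assumes "is_Y_reduction F R"
  shows "poly (spec_Z F c) b = poly (spec_Z R c) b"
proof -
  from assms obtain d where "R - F = (monom 1 CARD('a) - monom 1 1) * d"
    by (auto simp: is_Y_reduction_def)
  then have R: "R = F + (monom 1 CARD('a) - monom 1 1) * d"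
    by (simp add: algebra_simps)
  show ?thesis
    by (simp add: poly_spec_Z R poly_monom power_card_field)
qed

lemma coeff_spec_Z: "coeff (spec_Z F c) i = poly (coeff F i) c"
  by (simp add: spec_Z_def coeff_map_poly)

lemma degree_spec_Z_le: "degree (spec_Z F c) \<le> degree F"
  by (rule degree_le) (simp add: coeff_spec_Z coeff_eq_0)

text \<open>This form of the exact division exhibits both the drop in degree and the additional root
  0.\<close>

lemma spec_Z_eq_pCons_S_poly:
  fixes R :: "'a::{field,finite} poly poly"
  assumes "poly (coeff R 0) c = 0"
  shows "spec_Z R c = pCons 0 (S_poly R c)"
proof -
  obtain g where "spec_Z R c = pCons 0 g"
    using assms coeff_spec_Z[of R c 0] by (metis coeff_pCons_0 pCons_cases)
  then show ?thesis
    using assms nonzero_mult_div_cancel_left[of "[:0, 1:]" g] by (simp add: S_poly_def)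
qed

lemma degree_S_poly:
  fixes R :: "'a::{field,finite} poly poly"
  assumes "degree R \<le> CARD('a) - 1"
  shows "degree (S_poly R c) < CARD('a) - 1"
proof (cases "poly (coeff R 0) c = 0")
  case True
  show ?thesis
  \<comment> \<open>\<open>pCons 0\<close> raises the degree only of a nonzero polynomial.\<close>
  proof (cases "S_poly R c = 0")
    case False
    then show ?thesis
      using degree_spec_Z_le[of R c] assms by (simp add: spec_Z_eq_pCons_S_poly[OF True])
  qed (use card_field_ge2[where 'a = 'a] in simp)
next
  case False
  have "degree (S_poly R c) \<le> CARD('a) - 2"
    unfolding S_poly_def using False
    by (auto intro!: degree_add_le degree_sum_le order.trans[OF degree_monom_le])
  then show ?thesis using card_field_ge2[where 'a = 'a] by simp
qed

text \<open>At a unit the top power \<open>y ^ (q - 1)\<close> equals 1, so its coefficient may be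
  folded into the constant term.\<close>

lemma poly_S_poly:
  fixes R :: "'a::{field,finite} poly poly"
  assumes "degree R \<le> CARD('a) - 1" "poly (coeff R 0) c \<noteq> 0" "y \<noteq> 0"
  shows "poly (S_poly R c) y = poly (spec_Z R c) y"
proof -
  \<comment> \<open>For q = 2 this gives \<open>m = 0\<close>, and the middle sum over
    \<open>{1..m}\<close> is empty.\<close>
  obtain m where m: "CARD('a) = Suc (Suc m)"
    using card_field_ge2[where 'a = 'a] by (metis add_2_eq_Suc le_Suc_ex)
  let ?a = "\<lambda>i. poly (coeff R i) c * y ^ i"
  have "poly (spec_Z R c) y = (\<Sum>i<Suc (Suc m). ?a i)"
    using degree_spec_Z_le[of R c] assms(1) m
    by (subst poly_eq_sum_coeff[where n = "Suc (Suc m)"]) (auto simp: coeff_spec_Z)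
  also have "\<dots> = (\<Sum>i<Suc m. ?a i) + ?a (Suc m)" by simp
  also have "(\<Sum>i<Suc m. ?a i) = ?a 0 + (\<Sum>i = 1..m. ?a i)"
    unfolding sum.lessThan_Suc_shift by (simp add: sum.atLeast1_atMost_eq)
  also have "?a (Suc m) = poly (coeff R (Suc m)) c"
    using power_card_field_minus_1[OF assms(3)] m by simp
  finally show ?thesis
    using assms(2) m by (simp add: S_poly_def poly_sum poly_monom)
qed

lemma card_roots_spec_Z:
  fixes R :: "'a::{field,finite} poly poly"
  assumes "degree R \<le> CARD('a) - 1"
  shows "card {b. poly (spec_Z R c) b = 0} + left_circulant_rank (S_poly R c)
    = CARD('a) - 1 + (if poly (coeff R 0) c = 0 then 1 else 0)"
proof -
  let ?S = "{y. y \<noteq> 0 \<and> poly (S_poly R c) y = 0}"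
  have KR: "card ?S + left_circulant_rank (S_poly R c) = CARD('a) - 1"
    by (rule Koenig_Rados[OF degree_S_poly[OF assms]])
  show ?thesis
  proof (cases "poly (coeff R 0) c = 0")
    case True
    then have "{b. poly (spec_Z R c) b = 0} = insert 0 ?S"
      by (auto simp: spec_Z_eq_pCons_S_poly)
    then have "card {b. poly (spec_Z R c) b = 0} = card ?S + 1" by simp
    then show ?thesis using True KR by simp
  next
    case False
    then have "poly (spec_Z R c) 0 \<noteq> 0" by (simp add: poly_0_coeff_0 coeff_spec_Z)
    then have "{b. poly (spec_Z R c) b = 0} = ?S"
      using poly_S_poly[OF assms False] by (metis (mono_tags, lifting))
    then show ?thesis using False KR by simp
  qed
qed

theorem theorem4p16:
  fixes P :: "'a::{field,finite} poly poly"
    and Q :: "'a poly poly poly"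
    and R :: "'a poly poly"
    and \<gamma> :: "nat \<Rightarrow> 'a"
    and r t :: nat
  assumes "lead_coeff P = 1" and "degree P \<ge> 2"
    and "lead_coeff Q = 1" and "degree Q \<ge> 2"
    and "is_Y_reduction (Q_at_X0 Q) R"
    and "bij_betw \<gamma> {1..r} {c. poly (P_at_X0 P) c = 0}"
    and "t \<le> r"
    and "\<And>j. 1 \<le> j \<Longrightarrow> j \<le> t \<Longrightarrow> poly (coeff R 0) (\<gamma> j) = 0"
    and "\<And>j. t + 1 \<le> j \<Longrightarrow> j \<le> r \<Longrightarrow> poly (coeff R 0) (\<gamma> j) \<noteq> 0"
  shows "int (N0' P Q) =
           int r * (int CARD('a) - 1)
           - (\<Sum>j = 1..r. int (left_circulant_rank (S_poly R (\<gamma> j)))) + int t"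
proof -
  let ?B = "\<lambda>c. {b. poly (spec_Z R c) b = 0}"
  let ?e = "\<lambda>j. if poly (coeff R 0) (\<gamma> j) = 0 then 1 else 0 :: int"
  have deg: "degree R \<le> CARD('a) - 1"
    using assms(5) by (simp add: is_Y_reduction_def)
  \<comment> \<open>The pairs carry the \<open>Y\<close>-coordinate first; swapping them lets the
    count fibre over the roots \<open>c\<close>.\<close>
  have "{(b, c). poly (P_at_X0 P) c = 0 \<and> poly (spec_Z (Q_at_X0 Q) c) b = 0}
      = prod.swap ` Sigma {c. poly (P_at_X0 P) c = 0} ?B"
    by (auto simp: poly_spec_Z_Y_reduction[OF assms(5)])
  then have "N0' P Q = card (Sigma {c. poly (P_at_X0 P) c = 0} ?B)"
    by (simp add: N0'_def card_image)
  also have "\<dots> = (\<Sum>c | poly (P_at_X0 P) c = 0. card (?B c))"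
    by simp
  also have "\<dots> = (\<Sum>j = 1..r. card (?B (\<gamma> j)))"
    by (rule sum.reindex_bij_betw[OF assms(6), symmetric])
  finally have "int (N0' P Q) = (\<Sum>j = 1..r. int (card (?B (\<gamma> j))))"
    by simp
  also have "\<dots> = (\<Sum>j = 1..r. int CARD('a) - 1 - int (left_circulant_rank (S_poly R (\<gamma> j))) + ?e j)"
  proof (intro sum.cong refl)
    fix j
    show "int (card (?B (\<gamma> j)))
        = int CARD('a) - 1 - int (left_circulant_rank (S_poly R (\<gamma> j))) + ?e j"
      \<comment> \<open>The bound on q turns the truncated \<open>CARD('a) - 1\<close> into an
        integer difference.\<close>
      using card_roots_spec_Z[OF deg, of "\<gamma> j"] card_field_ge2[where 'a = 'a]
      by (auto split: if_splits)
  qed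
  also have "\<dots> = int r * (int CARD('a) - 1)
      - (\<Sum>j = 1..r. int (left_circulant_rank (S_poly R (\<gamma> j)))) + (\<Sum>j = 1..r. ?e j)"
    by (simp add: sum.distrib sum_subtractf)
  also have "(\<Sum>j = 1..r. ?e j) = (\<Sum>j = 1..t. 1)"
  proof (rule sum.mono_neutral_cong_right)
    show "\<forall>j\<in>{1..r} - {1..t}. ?e j = 0"
    proof
      fix j assume "j \<in> {1..r} - {1..t}"
      then have "t + 1 \<le> j" "j \<le> r" by auto
      then show "?e j = 0" using assms(9) by simp
    qed
  qed (use assms(7,8) in simp_all)
  finally show ?thesis by simp
qed

end
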